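(* Let $G=(V,E)$ be an undirected graph, $\mathcal{H}$ a set of unicast sessions in $G$, and $\mathbf{w}\in\mathbb{R}_{\ge 0}^{|E|}$ an edge-weight vector. If $\mathcal{H}$ can be partitioned into disjoint subsets $\mathcal{H}_1$ and $\mathcal{H}_2$ that are independent under $\mathbf{w}$, then the cost equality $J_{\text{code}}(\mathcal{H})=J_{\text{route}}(\mathcal{H})$ holds under $\mathbf{w}$ if and only if both $J_{\text{code}}(\mathcal{H}_1)=J_{\text{route}}(\mathcal{H}_1)$ and $J_{\text{code}}(\mathcal{H}_2)=J_{\text{route}}(\mathcal{H}_2)$ hold under $\mathbf{w}$.
   Context: Network model. $G=(V,E)$ is a finite undirected graph. A unicast session is an ordered pair $h_i=(s_i,t_i)$ of vertices (source, sink) with demand rate $r_i\ge 0$; $\mathcal{H}=\{h_1,\dots,h_k\}$. Each undirected edge $e=\{u,v\}$ is replaced by two opposing arcs $\vec{uv},\vec{vu}$. The sessions have mutually independent source messages $\mathcal{M}=\{M_1,\dots,M_k\}$; $M_i$ is generated at $s_i$ with rate $r_i$ and must be recovered at $t_i$. Coding and routing. A (network) coding solution is understood in the standard sense: the transmission on each arc is a sequence of random variables (symbols), each symbol sent by a node being a function of the messages generated at that node and the symbols it has already received, such that every $t_i$ can decode $M_i$. Its flow $f$ assigns to each arc the rate of transmission on it, and $f(e)=f(\vec{uv})+f(\vec{vu})$ for $e=\{u,v\}$. A routing solution only forwards uncoded message symbols, i.e. it is a fractional multicommodity flow. Cost. For a session set $\mathcal{H}'\subseteq\mathcal{H}$ (with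 the same demand rates), $J_{\text{code}}(\mathcal{H}')$ and $J_{\text{route}}(\mathcal{H}')$ denote the minimum total cost $\sum_{e\in E}w(e)f(e)$ required to satisfy the demands in $\mathcal{H}'$ using network coding and routing, respectively (no capacity constraints). A minimum-cost coding solution is one attaining $J_{\text{code}}$. Independence. Two disjoint subsets $\mathcal{H}_1,\mathcal{H}_2\subseteq\mathcal{H}$ are independent under $\mathbf{w}$ if there exists a minimum-cost coding solution for $\mathcal{H}$ such that, for every $h_i\in\mathcal{H}_1$, every $h_j\in\mathcal{H}_2$, every edge $e\in E$, and every symbol $X$ transmitted on $e$ by that solution, $$I(X;M_i\mid \mathbf{M}_{\setminus\{i\}})\cdot I(X;M_j\mid \mathbf{M}_{\setminus\{j\}})=0,$$ where $\mathbf{M}_{\setminus\{l\}}=\mathcal{M}\setminus\{M_l\}$ and $I$ denotes (conditional) mutual information. *)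

theory Defs
  imports "HOL-Probability.Probability"
begin

definition undirected_graph :: "'v set \<Rightarrow> 'v set set \<Rightarrow> bool" where
  "undirected_graph V E \<longleftrightarrow>
     finite V \<and> (\<forall>e\<in>E. \<exists>u\<in>V. \<exists>v\<in>V. u \<noteq> v \<and> e = {u, v})"

type_synonym 'v arc = "'v \<times> 'v"
type_synonym 'v session = "'v \<times> 'v"  \<comment> \<open>(source, sink)\<close>

definition arcs :: "'v set set \<Rightarrow> 'v arc set" where
  "arcs E = {(u, v). {u, v} \<in> E}"

text \<open>A flow gives a rate to every arc; the flow on an undirected edge is the sum over its two
  arcs.\<close>

definition edge_flow :: "('v arc \<Rightarrow> real) \<Rightarrow> 'v set \<Rightarrow> real" where
  "edge_flow f e = (\<Sum>a\<in>{(u, v). {u, v} = e}. f a)"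

definition flow_cost :: "'v set set \<Rightarrow> ('v set \<Rightarrow> real) \<Rightarrow> ('v arc \<Rightarrow> real) \<Rightarrow> real" where
  "flow_cost E w f = (\<Sum>e\<in>E. w e * edge_flow f e)"


subsection \<open>Network coding\<close>

text \<open>The source messages are mutually independent random variables with finite alphabets, so
  without loss of generality the sample space is the space of message tuples with the product
  of the individual message laws; message \<open>M\<^sub>h\<close> is the projection to component \<open>h\<close>, and components
  outside the session set \<open>H\<close> are fixed to \<open>0\<close>. The measure is restricted to the (finite) support,
  so that every function on tuples is a simple random variable.\<close>

type_synonym 'v messages = "'v session \<Rightarrow> nat"

definition message_space ::
  "'v session set \<Rightarrow> ('v session \<Rightarrow> nat pmf) \<Rightarrow> 'v messages measure" where
  "message_space H p =
     restrict_space (measure_pmf (Pi_pmf H 0 p)) (set_pmf (Pi_pmf H 0 p))"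

text \<open>Entropy and conditional mutual information in bits. These are the notions of the library
  locale for discrete random variables, at base \<open>2\<close>.\<close>

definition entropy_bits :: "'a measure \<Rightarrow> ('a \<Rightarrow> 'b) \<Rightarrow> real" where
  "entropy_bits M X = prob_space.entropy M 2 (count_space (X ` space M)) X"

definition cond_mutual_info_bits ::
  "'a measure \<Rightarrow> ('a \<Rightarrow> 'b) \<Rightarrow> ('a \<Rightarrow> 'c) \<Rightarrow> ('a \<Rightarrow> 'd) \<Rightarrow> real" where
  "cond_mutual_info_bits M X Y Z =
     prob_space.conditional_mutual_information M 2
       (count_space (X ` space M)) (count_space (Y ` space M)) (count_space (Z ` space M)) X Y Z"

text \<open>A transmission is a symbol (a random variable on the message tuples) sent over an arc. A code
  consists of a block length, the laws of the messages emitted during one block, and the list of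
  all transmissions of one block in chronological order.\<close>

type_synonym 'v transmission = "'v arc \<times> ('v messages \<Rightarrow> nat)"

record 'v code =
  block_length :: nat
  message_law :: "'v session \<Rightarrow> nat pmf"
  transmissions :: "'v transmission list"

abbreviation code_space :: "'v session set \<Rightarrow> 'v code \<Rightarrow> 'v messages measure" where
  "code_space H C \<equiv> message_space H (message_law C)"

text \<open>What node \<open>u\<close> knows after the transmissions \<open>ts\<close>: the messages generated at \<open>u\<close>, and the
  sequence of symbols received by \<open>u\<close>, each with the arc it arrived on.\<close>

definition node_view ::
  "'v session set \<Rightarrow> 'v \<Rightarrow> 'v transmission list \<Rightarrow> 'v messages \<Rightarrow>
     ('v session \<Rightarrow> nat) \<times> ('v arc \<times> nat) list" where
  "node_view H u ts m =
     (restrict m {h \<in> H. fst h = u},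
      map (\<lambda>(a, X). (a, X m)) (filter (\<lambda>(a, X). snd a = u) ts))"

definition coding_solution ::
  "'v set set \<Rightarrow> ('v session \<Rightarrow> real) \<Rightarrow> 'v session set \<Rightarrow> 'v code \<Rightarrow> bool" where
  "coding_solution E r H C \<longleftrightarrow>
     block_length C > 0 \<and>
     (\<forall>h\<in>H. finite (set_pmf (message_law C h)) \<and>
        entropy_bits (code_space H C) (\<lambda>m. m h) = real (block_length C) * r h) \<and>
     (\<forall>k < length (transmissions C).
        case transmissions C ! k of (a, X) \<Rightarrow>
          a \<in> arcs E \<and>
          (\<exists>g. \<forall>m \<in> space (code_space H C).
             X m = g (node_view H (fst a) (take k (transmissions C)) m))) \<and>
     (\<forall>h\<in>H. \<exists>d. \<forall>m \<in> space (code_space H C).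
        m h = d (node_view H (snd h) (transmissions C) m))"

text \<open>The rate of transmission on an arc is the joint entropy of the sequence of symbols sent over
  it, per unit of block length.\<close>

definition arc_transmission :: "'v code \<Rightarrow> 'v arc \<Rightarrow> 'v messages \<Rightarrow> nat list" where
  "arc_transmission C a m = map (\<lambda>(b, X). X m) (filter (\<lambda>(b, X). b = a) (transmissions C))"

definition code_flow :: "'v session set \<Rightarrow> 'v code \<Rightarrow> 'v arc \<Rightarrow> real" where
  "code_flow H C a =
     entropy_bits (code_space H C) (arc_transmission C a) / real (block_length C)"

text \<open>Minimum costs are infima in the extended reals, hence \<open>\<infinity>\<close> if the demands cannot be met.\<close>

definition J_code ::
  "'v set set \<Rightarrow> ('v set \<Rightarrow> real) \<Rightarrow> ('v session \<Rightarrow> real) \<Rightarrow> 'v session set \<Rightarrow> ereal" where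
  "J_code E w r H = (INF C \<in> {C. coding_solution E r H C}. ereal (flow_cost E w (code_flow H C)))"

definition min_cost_coding_solution ::
  "'v set set \<Rightarrow> ('v set \<Rightarrow> real) \<Rightarrow> ('v session \<Rightarrow> real) \<Rightarrow> 'v session set \<Rightarrow> 'v code \<Rightarrow> bool" where
  "min_cost_coding_solution E w r H C \<longleftrightarrow>
     coding_solution E r H C \<and> ereal (flow_cost E w (code_flow H C)) = J_code E w r H"


subsection \<open>Routing\<close>

text \<open>Fractional multicommodity flows with one commodity per session; the net outflow of commodity
  \<open>h\<close> is \<open>r h\<close> at its source, \<open>- r h\<close> at its sink and zero elsewhere.\<close>

definition routing_solution ::
  "'v set \<Rightarrow> 'v set set \<Rightarrow> ('v session \<Rightarrow> real) \<Rightarrow> 'v session set \<Rightarrow>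
     ('v session \<Rightarrow> 'v arc \<Rightarrow> real) \<Rightarrow> bool" where
  "routing_solution V E r H \<phi> \<longleftrightarrow>
     (\<forall>h\<in>H. (\<forall>a\<in>arcs E. 0 \<le> \<phi> h a) \<and>
        (\<forall>v\<in>V. (\<Sum>a\<in>{a \<in> arcs E. fst a = v}. \<phi> h a) - (\<Sum>a\<in>{a \<in> arcs E. snd a = v}. \<phi> h a)
                = r h * (of_bool (v = fst h) - of_bool (v = snd h))))"

definition J_route ::
  "'v set \<Rightarrow> 'v set set \<Rightarrow> ('v set \<Rightarrow> real) \<Rightarrow> ('v session \<Rightarrow> real) \<Rightarrow> 'v session set \<Rightarrow> ereal" where
  "J_route V E w r H =
     (INF \<phi> \<in> {\<phi>. routing_solution V E r H \<phi>}. ereal (flow_cost E w (\<lambda>a. \<Sum>h\<in>H. \<phi> h a)))"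


subsection \<open>Independence of session sets\<close>

definition independent_sessions ::
  "'v set set \<Rightarrow> ('v set \<Rightarrow> real) \<Rightarrow> ('v session \<Rightarrow> real) \<Rightarrow> 'v session set \<Rightarrow>
     'v session set \<Rightarrow> 'v session set \<Rightarrow> bool" where
  "independent_sessions E w r H H1 H2 \<longleftrightarrow>
     H1 \<subseteq> H \<and> H2 \<subseteq> H \<and> H1 \<inter> H2 = {} \<and>
     (\<exists>C. min_cost_coding_solution E w r H C \<and>
        (\<forall>i\<in>H1. \<forall>j\<in>H2. \<forall>e\<in>E. \<forall>(a, X) \<in> set (transmissions C). {fst a, snd a} = e \<longrightarrow>
           cond_mutual_info_bits (code_space H C) X (\<lambda>m. m i) (\<lambda>m. restrict m (H - {i})) *
           cond_mutual_info_bits (code_space H C) X (\<lambda>m. m j) (\<lambda>m. restrict m (H - {j})) = 0))"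

end

(* Sending a message uncoded along a near-shortest walk adds at most the cost of any flow for its
   session, so J_code(H1 u H2) <= J_code(H1) + J_route(H2) for disjoint H1, H2. In an optimal code
   witnessing independence, every symbol is a function of the messages of H1 alone or of those of
   H2 alone: zero conditional mutual information means that the symbol does not change with the
   message. Freezing the messages of H2, resp. H1, at fixed values splits this code into codes for
   H1 and H2 whose flows add up, whence J_code(H1) + J_code(H2) <= J_code(H). As J_route is
   additive and dominates J_code, the equivalence follows from the two inequalities. *)

theory Submission
  imports Defs "HOL-Real_Asymp.Real_Asymp"
begin

subsection \<open>Entropy of finitely supported probability mass functions\<close>

text \<open>A code consists of arbitrary laws and unspecified encoding functions, measured by
  entropies, while routing is linear. Two devices bridge this gap. First, conditions on codes are
  read through kernels: a node can compute a function if it is constant wherever the node's view is,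
  and the entropy of a function depends only on the partition that it induces on the support.
  Second, the support of independent messages is a product set, so messages can be changed one at a
  time without leaving it.

  The bound that mixes a coded half with a routed half has a reason: adding J_code(H1) and
  J_code(H2) directly would mean merging codes of different block lengths, whereas a single walk can
  be added to a code at its own block length. It is strong enough: if J_code(H) = J_route(H1) +
  J_route(H2), then the finite term J_route(H2) cancels from J_code(H) <= J_code(H1) + J_route(H2),
  and symmetrically for H1.\<close>

definition pmf_entropy :: "'a pmf \<Rightarrow> real" where
  "pmf_entropy q = - (\<Sum>x\<in>set_pmf q. pmf q x * log 2 (pmf q x))"

text \<open>The construction of \<open>message_space\<close> for an arbitrary law, so that data
  processing can be borrowed from the library for any finitely supported \<open>q\<close>.\<close>

definition support_space :: "'a pmf \<Rightarrow> 'a measure" where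
  "support_space P = restrict_space (measure_pmf P) (set_pmf P)"

lemma message_space_eq: "message_space H p = support_space (Pi_pmf H 0 p)"
  by (simp add: message_space_def support_space_def)

lemma space_support_space [simp]: "space (support_space P) = set_pmf P"
  by (simp add: support_space_def space_restrict_space)

lemma sets_support_space [simp]: "sets (support_space P) = Pow (set_pmf P)"
  by (auto simp: support_space_def sets_restrict_space)

lemma measure_support_space:
  assumes "A \<subseteq> set_pmf P"
  shows "measure (support_space P) A = measure_pmf.prob P A"
  unfolding support_space_def using assms by (subst measure_restrict_space) auto

lemma information_space_support_space: "information_space (support_space P) 2"
proof -
  have "emeasure (support_space P) (set_pmf P) = 1"
    unfolding support_space_def
    by (subst emeasure_restrict_space) (auto simp: measure_pmf.emeasure_eq_measure measure_pmf.prob_eq_1 AE_measure_pmf_iff)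
  then interpret prob_space "support_space P"
    by (intro prob_spaceI) simp
  show ?thesis by unfold_locales simp
qed

lemma simple_function_support_space:
  assumes "finite (set_pmf P)"
  shows "simple_function (support_space P) X"
  using assms by (auto simp: simple_function_def)

lemma simple_distributed_support_space:
  assumes "finite (set_pmf P)"
  shows "simple_distributed (support_space P) X (pmf (map_pmf X P))"
proof -
  interpret information_space "support_space P" 2 by (rule information_space_support_space)
  show ?thesis
  proof (rule simple_distributedI[OF simple_function_support_space[OF assms]])
    fix x
    have "measure_pmf.prob P (X -` {x}) = measure_pmf.prob P (X -` {x} \<inter> set_pmf P)"
      by (simp add: measure_Int_set_pmf)
    then show "pmf (map_pmf X P) x = prob (X -` {x} \<inter> space (support_space P))"
      by (simp add: pmf_map measure_support_space)
  qed auto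
qed

text \<open>From here on entropies are functions of a law alone, where injections, projections and
  products are easy to handle.\<close>

lemma entropy_bits_support_space:
  assumes "finite (set_pmf P)"
  shows "entropy_bits (support_space P) X = pmf_entropy (map_pmf X P)"
proof -
  interpret information_space "support_space P" 2 by (rule information_space_support_space)
  show ?thesis
    unfolding entropy_bits_def
    by (subst entropy_simple_distributed[OF simple_distributed_support_space[OF assms]])
       (simp add: pmf_entropy_def)
qed

text \<open>If \<open>Y\<close> and \<open>Z\<close> determine \<open>X\<close>, then I(X;Y|Z) is
  the conditional entropy H(X|Z), a sum of nonnegative terms. If it vanishes, so does each term, and
  each value of \<open>Z\<close> leaves room for a single value of \<open>X\<close> on the
  support.\<close>

lemma cond_mutual_info_bits_zero_imp:
  assumes fin: "finite (set_pmf P)"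
    and det: "\<And>m m'. m \<in> set_pmf P \<Longrightarrow> m' \<in> set_pmf P \<Longrightarrow> Y m = Y m' \<Longrightarrow> Z m = Z m' \<Longrightarrow> X m = X m'"
    and zero: "cond_mutual_info_bits (support_space P) X Y Z = 0"
    and m: "m \<in> set_pmf P" and m': "m' \<in> set_pmf P" and Z: "Z m = Z m'"
  shows "X m = X m'"
proof (rule ccontr)
  assume neq: "X m \<noteq> X m'"
  interpret information_space "support_space P" 2 by (rule information_space_support_space)
  let ?T = "\<lambda>x. (X x, Y x, Z x)"
  let ?z = "pmf (map_pmf Z P)" and ?yz = "pmf (map_pmf (\<lambda>x. (Y x, Z x)) P)"
  let ?xz = "pmf (map_pmf (\<lambda>x. (X x, Z x)) P)" and ?xyz = "pmf (map_pmf ?T P)"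
  let ?g = "\<lambda>(x, y, z). ?xyz (x, y, z) * log 2 (?xyz (x, y, z) / (?xz (x, z) * (?yz (y, z) / ?z z)))"
  have eq: "(\<Sum>t\<in>?T ` set_pmf P. ?g t) = 0"
    using zero unfolding cond_mutual_info_bits_def
    by (subst (asm) conditional_mutual_information_eq
          [OF simple_distributed_support_space simple_distributed_support_space
              simple_distributed_support_space simple_distributed_support_space])
       (simp_all add: fin)
  have pos: "0 < pmf (map_pmf f P) (f x)" if "x \<in> set_pmf P" for f :: "'a \<Rightarrow> 'x" and x
    using that by (simp add: pmf_positive)
  \<comment> \<open>By \<open>det\<close> the event fixing \<open>X\<close>, \<open>Y\<close> and
    \<open>Z\<close> is on the support the one fixing \<open>Y\<close> and \<open>Z\<close>, so the
    summand collapses to one of H(X|Z).\<close>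
  have val: "?g (?T x) = ?yz (Y x, Z x) * log 2 (?z (Z x) / ?xz (X x, Z x))"
    if x: "x \<in> set_pmf P" for x
  proof -
    have "?xyz (?T x) = measure_pmf.prob P (?T -` {?T x} \<inter> set_pmf P)"
      by (simp add: pmf_map measure_Int_set_pmf)
    also have "?T -` {?T x} \<inter> set_pmf P = (\<lambda>x. (Y x, Z x)) -` {(Y x, Z x)} \<inter> set_pmf P"
      using det[OF _ x] by auto
    also have "measure_pmf.prob P \<dots> = ?yz (Y x, Z x)"
      by (simp add: pmf_map measure_Int_set_pmf)
    finally have 1: "?xyz (?T x) = ?yz (Y x, Z x)" .
    show ?thesis
      using pos[OF x, of "\<lambda>x. (Y x, Z x)"] by (simp add: 1)
  qed
  have le: "?xz (X x, Z x) \<le> ?z (Z x)" for x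
    unfolding pmf_map by (intro measure_pmf.finite_measure_mono) auto
  have nonneg: "0 \<le> ?g t" if "t \<in> ?T ` set_pmf P" for t
  proof -
    from that obtain x where x: "x \<in> set_pmf P" "t = ?T x" by auto
    have "1 \<le> ?z (Z x) / ?xz (X x, Z x)"
      using le[of x] pos[OF x(1), of "\<lambda>x. (X x, Z x)"] by simp
    then show ?thesis
      unfolding x(2) val[OF x(1)] by simp
  qed
  have "?g (?T m) = 0"
    using eq sum_nonneg_eq_0_iff[of "?T ` set_pmf P" ?g] fin nonneg m by blast
  then have "log 2 (?z (Z m) / ?xz (X m, Z m)) = 0"
    unfolding val[OF m] using pos[OF m, of "\<lambda>x. (Y x, Z x)"] by simp
  then have "?z (Z m) / ?xz (X m, Z m) = 1"
    using pos[OF m, of Z] pos[OF m, of "\<lambda>x. (X x, Z x)"] by (simp add: log_def)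
  then have same: "?z (Z m) = ?xz (X m, Z m)"
    using pos[OF m, of "\<lambda>x. (X x, Z x)"] by simp
  \<comment> \<open>The point \<open>m'\<close> lies in the fibre of \<open>Z\<close> but not in
    that of \<open>(X, Z)\<close>, so its positive mass would separate two equal
    probabilities.\<close>
  have "?xz (X m, Z m) + pmf P m' = measure_pmf.prob P ((\<lambda>x. (X x, Z x)) -` {(X m, Z m)} \<union> {m'})"
    unfolding pmf_map
    by (subst measure_pmf.finite_measure_Union) (use neq in \<open>auto simp: measure_pmf_single\<close>)
  also have "\<dots> \<le> ?z (Z m)"
    unfolding pmf_map using Z by (intro measure_pmf.finite_measure_mono) auto
  finally show False
    using same pmf_positive[OF m'] by simp
qed

section \<open>Entropy under maps and products\<close>

lemma pmf_entropy_map_inj: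
  assumes "inj_on f (set_pmf q)"
  shows "pmf_entropy (map_pmf f q) = pmf_entropy q"
  unfolding pmf_entropy_def
  by (simp add: sum.reindex[OF assms] pmf_map_inj[OF assms])

lemma pmf_entropy_map_le:
  assumes "finite (set_pmf q)"
  shows "pmf_entropy (map_pmf f q) \<le> pmf_entropy q"
proof -
  interpret information_space "support_space q" 2 by (rule information_space_support_space)
  have "entropy_bits (support_space q) (f \<circ> id) \<le> entropy_bits (support_space q) id"
    unfolding entropy_bits_def
    by (rule entropy_data_processing[OF simple_function_support_space[OF assms]])
  then show ?thesis by (simp add: entropy_bits_support_space[OF assms])
qed

text \<open>Functions with the same fibres on the support differ by an injective relabelling of
  their values. The kernel form spares writing the relabelling down, even between different
  codomains.\<close>

lemma pmf_entropy_map_eq_of_kernel: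
  assumes "\<And>m m'. m \<in> set_pmf P \<Longrightarrow> m' \<in> set_pmf P \<Longrightarrow> f m = f m' \<longleftrightarrow> g m = g m'"
  shows "pmf_entropy (map_pmf f P) = pmf_entropy (map_pmf g P)"
proof -
  let ?k = "\<lambda>y. g (inv_into (set_pmf P) f y)"
  have inv: "g (inv_into (set_pmf P) f (f m)) = g m" if "m \<in> set_pmf P" for m
    using assms[of "inv_into (set_pmf P) f (f m)" m] that
    by (simp add: f_inv_into_f inv_into_into)
  have "map_pmf g P = map_pmf ?k (map_pmf f P)"
    unfolding pmf.map_comp by (rule pmf.map_cong) (auto simp: inv)
  moreover have "inj_on ?k (set_pmf (map_pmf f P))"
    by (rule inj_onI) (use assms in \<open>auto simp: inv\<close>)
  ultimately show ?thesis by (simp add: pmf_entropy_map_inj)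
qed

text \<open>The pair of \<open>f\<close> and \<open>g\<close> has the fibres of \<open>f\<close> and
  projects onto \<open>g\<close>.\<close>

lemma pmf_entropy_map_le_of_kernel:
  assumes "finite (set_pmf P)"
    and "\<And>m m'. m \<in> set_pmf P \<Longrightarrow> m' \<in> set_pmf P \<Longrightarrow> f m = f m' \<Longrightarrow> g m = g m'"
  shows "pmf_entropy (map_pmf g P) \<le> pmf_entropy (map_pmf f P)"
proof -
  let ?h = "\<lambda>m. (f m, g m)"
  have "map_pmf g P = map_pmf snd (map_pmf ?h P)" by (simp add: pmf.map_comp comp_def)
  then have "pmf_entropy (map_pmf g P) \<le> pmf_entropy (map_pmf ?h P)"
    using pmf_entropy_map_le[of "map_pmf ?h P" snd] assms(1) by simp
  also have "\<dots> = pmf_entropy (map_pmf f P)"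
    by (rule pmf_entropy_map_eq_of_kernel) (blast dest: assms(2))
  finally show ?thesis .
qed

lemma pmf_entropy_nonneg: "0 \<le> pmf_entropy q"
proof -
  have "pmf q x * log 2 (pmf q x) \<le> 0" if "x \<in> set_pmf q" for x
    using pmf_positive[OF that] pmf_le_1[of q x] by (simp add: mult_nonneg_nonpos)
  then show ?thesis
    unfolding pmf_entropy_def by (simp add: sum_nonpos)
qed

lemma sum_pmf_support: "finite (set_pmf q) \<Longrightarrow> (\<Sum>x\<in>set_pmf q. pmf q x) = 1"
  by (rule sum_pmf_eq_1) auto

lemma pmf_entropy_pair:
  assumes "finite (set_pmf p)" "finite (set_pmf q)"
  shows "pmf_entropy (pair_pmf p q) = pmf_entropy p + pmf_entropy q"
proof -
  have "(\<Sum>z\<in>set_pmf p \<times> set_pmf q. pmf (pair_pmf p q) z * log 2 (pmf (pair_pmf p q) z))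
    = (\<Sum>x\<in>set_pmf p. \<Sum>y\<in>set_pmf q. (pmf p x * log 2 (pmf p x)) * pmf q y + pmf p x * (pmf q y * log 2 (pmf q y)))"
    unfolding sum.cartesian_product
  proof (rule sum.cong[OF refl], clarify)
    fix x y assume "x \<in> set_pmf p" "y \<in> set_pmf q"
    then have "0 < pmf p x" "0 < pmf q y" by (simp_all add: pmf_positive)
    then show "pmf (pair_pmf p q) (x, y) * log 2 (pmf (pair_pmf p q) (x, y)) =
        (pmf p x * log 2 (pmf p x)) * pmf q y + pmf p x * (pmf q y * log 2 (pmf q y))"
      by (simp add: pmf_pair log_mult algebra_simps)
  qed
  also have "\<dots> = (\<Sum>x\<in>set_pmf p. pmf p x * log 2 (pmf p x)) + (\<Sum>y\<in>set_pmf q. pmf q y * log 2 (pmf q y))"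
    using assms by (simp add: sum.distrib sum_distrib_left[symmetric] sum_distrib_right[symmetric] sum_pmf_support)
  finally show ?thesis by (simp add: pmf_entropy_def)
qed

section \<open>Every nonnegative real is an entropy\<close>

lemma pmf_entropy_bernoulli:
  assumes "0 < t" "t < 1"
  shows "pmf_entropy (bernoulli_pmf t) = - (t * log 2 t + (1 - t) * log 2 (1 - t))"
  using assms by (simp add: pmf_entropy_def set_pmf_bernoulli UNIV_bool)

text \<open>Binary entropy tends to 0 at 0 and equals 1 at 1/2, so the intermediate value theorem
  applies. The left endpoint is a small positive \<open>e\<close>, because the logarithm is
  continuous only away from 0.\<close>

lemma exists_bernoulli_entropy:
  assumes "0 < y" "y < 1"
  shows "\<exists>t. 0 < t \<and> t < 1 \<and> pmf_entropy (bernoulli_pmf t) = y"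
proof -
  let ?h = "\<lambda>t::real. - (t * log 2 t + (1 - t) * log 2 (1 - t))"
  have "(?h \<longlongrightarrow> 0) (at_right 0)" unfolding log_def by real_asymp
  then have "eventually (\<lambda>t. ?h t < y) (at_right 0)"
    using assms(1) by (rule order_tendstoD(2))
  moreover have "eventually (\<lambda>t::real. t \<in> {0<..<1/2}) (at_right 0)"
    by (rule eventually_at_right_real) simp
  ultimately have "eventually (\<lambda>t. ?h t < y \<and> t \<in> {0<..<1/2}) (at_right 0)"
    by (rule eventually_conj)
  then obtain e where e: "?h e < y" "0 < e" "e < 1/2"
    using eventually_happens'[OF trivial_limit_at_right_real] by fastforce
  have half: "?h (1/2) = 1" by (simp add: log_divide)
  have "continuous_on {e..1/2} ?h"
    using e by (intro continuous_intros) auto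
  then obtain t where "e \<le> t" "t \<le> 1/2" "?h t = y"
    using IVT'[of ?h e y "1/2"] e half assms(2) by auto
  then show ?thesis
    using e by (intro exI[of _ t]) (auto simp: pmf_entropy_bernoulli)
qed

text \<open>The integer part of \<open>x\<close> comes from a uniform law on 2^k values, the
  fractional part from a law on two values, and an independent pair adds the two.\<close>

lemma exists_pmf_entropy:
  assumes "0 \<le> x"
  shows "\<exists>q :: nat pmf. finite (set_pmf q) \<and> pmf_entropy q = x"
proof -
  define k where "k = nat \<lfloor>x\<rfloor>"
  define y where "y = x - real k"
  have y: "0 \<le> y" "y < 1" and x: "x = real k + y"
    using assms by (auto simp: k_def y_def; linarith)+
  have "\<exists>b :: bool pmf. pmf_entropy b = y"
  proof (cases "y = 0")
    case True
    then show ?thesis by (intro exI[of _ "return_pmf True"]) (simp add: pmf_entropy_def)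
  next
    case False
    then show ?thesis using exists_bernoulli_entropy[of y] y by auto
  qed
  then obtain b :: "bool pmf" where b: "pmf_entropy b = y" by blast
  define u where "u = pmf_of_set {..<(2::nat) ^ k}"
  have ne: "{..<(2::nat) ^ k} \<noteq> {}" by (simp add: lessThan_empty_iff)
  have u: "set_pmf u = {..<2 ^ k}" "pmf_entropy u = real k"
    by (simp_all add: pmf_entropy_def u_def ne pmf_of_set log_divide log_nat_power)
  define q where "q = map_pmf to_nat (pair_pmf u b)"
  have "pmf_entropy q = pmf_entropy (pair_pmf u b)"
    unfolding q_def by (rule pmf_entropy_map_inj) (rule inj_on_subset[OF inj_to_nat], simp)
  moreover have "finite (set_pmf q)"
    by (simp add: q_def u)
  ultimately show ?thesis
    using b u x by (auto simp: pmf_entropy_pair)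
qed

subsection \<open>Flows, codes and walks\<close>

lemma finite_arcs:
  assumes "undirected_graph V E"
  shows "finite (arcs E)"
proof (rule finite_subset)
  show "arcs E \<subseteq> V \<times> V"
    using assms unfolding undirected_graph_def arcs_def by (fastforce simp: doubleton_eq_iff)
  show "finite (V \<times> V)"
    using assms by (simp add: undirected_graph_def)
qed

lemma flow_cost_eq_sum_arcs:
  assumes "undirected_graph V E"
  shows "flow_cost E w f = (\<Sum>a\<in>arcs E. w {fst a, snd a} * f a)"
proof -
  let ?A = "\<lambda>e. {(u, v). {u, v} = e}"
  have "E \<subseteq> Pow V" using assms unfolding undirected_graph_def by fastforce
  then have finE: "finite E"
    using assms by (meson finite_Pow_iff finite_subset undirected_graph_def)
  have fin: "finite (?A e)" if "e \<in> E" for e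
  proof (rule finite_subset)
    show "?A e \<subseteq> e \<times> e" by auto
    show "finite (e \<times> e)" using that \<open>E \<subseteq> Pow V\<close> assms
      by (meson PowD finite_SigmaI finite_subset subsetD undirected_graph_def)
  qed
  have "arcs E = (\<Union>e\<in>E. ?A e)" by (auto simp: arcs_def)
  then have "(\<Sum>a\<in>arcs E. w {fst a, snd a} * f a) = (\<Sum>e\<in>E. \<Sum>a\<in>?A e. w {fst a, snd a} * f a)"
    using finE fin by (simp only:) (rule sum.UNION_disjoint, auto)
  also have "\<dots> = (\<Sum>e\<in>E. w e * edge_flow f e)"
    by (intro sum.cong refl) (auto simp: edge_flow_def sum_distrib_left intro!: sum.cong)
  finally show ?thesis by (simp add: flow_cost_def)
qed

lemma flow_cost_mono:
  assumes "undirected_graph V E" "\<forall>e\<in>E. 0 \<le> w e" "\<And>a. a \<in> arcs E \<Longrightarrow> f a \<le> g a"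
  shows "flow_cost E w f \<le> flow_cost E w g"
  unfolding flow_cost_eq_sum_arcs[OF assms(1)]
  by (intro sum_mono mult_left_mono assms(3)) (use assms(2) in \<open>auto simp: arcs_def\<close>)

lemma flow_cost_nonneg:
  assumes "undirected_graph V E" "\<forall>e\<in>E. 0 \<le> w e" "\<And>a. a \<in> arcs E \<Longrightarrow> 0 \<le> f a"
  shows "0 \<le> flow_cost E w f"
  using flow_cost_mono[OF assms(1,2), of "\<lambda>_. 0" f] assms(3)
  by (simp add: flow_cost_def edge_flow_def)

lemma flow_cost_add: "flow_cost E w (\<lambda>a. f a + g a) = flow_cost E w f + flow_cost E w g"
  by (simp add: flow_cost_def edge_flow_def sum.distrib distrib_left)

section \<open>Code conditions in kernel form\<close>

lemma node_view_eq_iff: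
  "node_view H u ts m = node_view H u ts m' \<longleftrightarrow>
     (\<forall>h\<in>H. fst h = u \<longrightarrow> m h = m' h) \<and> (\<forall>(a, X)\<in>set ts. snd a = u \<longrightarrow> X m = X m')"
  by (auto simp: node_view_def restrict_def fun_eq_iff split: if_splits)

lemma arc_transmission_eq_iff:
  "arc_transmission C a m = arc_transmission C a m' \<longleftrightarrow>
     (\<forall>(b, X)\<in>set (transmissions C). b = a \<longrightarrow> X m = X m')"
  by (auto simp: arc_transmission_def)

text \<open>The support of the joint message law, written as a product set.\<close>

definition code_tuples :: "'v session set \<Rightarrow> 'v code \<Rightarrow> 'v messages set" where
  "code_tuples H C = PiE_dflt H 0 (set_pmf \<circ> message_law C)"

lemma space_code_space: "finite H \<Longrightarrow> space (code_space H C) = code_tuples H C"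
  by (simp add: message_space_eq code_tuples_def set_Pi_pmf)

lemma finite_support_Pi_pmf:
  assumes "finite H" "\<forall>h\<in>H. finite (set_pmf (p h))"
  shows "finite (set_pmf (Pi_pmf H dflt p))"
  using assms by (subst set_Pi_pmf) auto

text \<open>The factor sends a value of \<open>f\<close> to \<open>X\<close> at a chosen preimage in
  \<open>S\<close>; the kernel condition makes the choice harmless.\<close>

lemma factors_through_iff:
  "(\<exists>g. \<forall>m\<in>S. X m = g (f m)) \<longleftrightarrow> (\<forall>m\<in>S. \<forall>m'\<in>S. f m = f m' \<longrightarrow> X m = X m')"
proof
  assume R: "\<forall>m\<in>S. \<forall>m'\<in>S. f m = f m' \<longrightarrow> X m = X m'"
  have "X m = X (inv_into S f (f m))" if "m \<in> S" for m
    using R that by (metis f_inv_into_f image_eqI inv_into_into)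
  then show "\<exists>g. \<forall>m\<in>S. X m = g (f m)"
    by (intro exI[of _ "\<lambda>y. X (inv_into S f y)"]) simp
qed auto

text \<open>\<open>u\<close> sees enough to compute \<open>X\<close>: stated through the kernel of the view, so that no
  encoding or decoding functions have to be constructed.\<close>

definition computable_at ::
  "'v session set \<Rightarrow> 'v messages set \<Rightarrow> 'v \<Rightarrow> 'v transmission list \<Rightarrow> ('v messages \<Rightarrow> nat) \<Rightarrow> bool" where
  "computable_at H S u ts X \<longleftrightarrow>
     (\<forall>m\<in>S. \<forall>m'\<in>S. (\<forall>h\<in>H. fst h = u \<longrightarrow> m h = m' h) \<longrightarrow>
        (\<forall>(a, Y)\<in>set ts. snd a = u \<longrightarrow> Y m = Y m') \<longrightarrow> X m = X m')"

lemma computable_at_iff: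
  "computable_at H S u ts X \<longleftrightarrow> (\<exists>g. \<forall>m\<in>S. X m = g (node_view H u ts m))"
  unfolding factors_through_iff node_view_eq_iff computable_at_def by blast

lemma entropy_message_component:
  assumes "finite H" "\<forall>h\<in>H. finite (set_pmf (message_law C h))" "h \<in> H"
  shows "entropy_bits (code_space H C) (\<lambda>m. m h) = pmf_entropy (message_law C h)"
  using assms
  by (simp add: message_space_eq entropy_bits_support_space finite_support_Pi_pmf Pi_pmf_component)

lemma coding_solution_iff:
  assumes "finite H"
  shows "coding_solution E r H C \<longleftrightarrow>
     block_length C > 0 \<and>
     (\<forall>h\<in>H. finite (set_pmf (message_law C h)) \<and>
        pmf_entropy (message_law C h) = real (block_length C) * r h) \<and>
     (\<forall>k < length (transmissions C). fst (transmissions C ! k) \<in> arcs E \<and>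
        computable_at H (code_tuples H C) (fst (fst (transmissions C ! k)))
          (take k (transmissions C)) (snd (transmissions C ! k))) \<and>
     (\<forall>h\<in>H. computable_at H (code_tuples H C) (snd h) (transmissions C) (\<lambda>m. m h))"
proof -
  have "(\<forall>h\<in>H. finite (set_pmf (message_law C h)) \<and>
           entropy_bits (code_space H C) (\<lambda>m. m h) = real (block_length C) * r h) \<longleftrightarrow>
        (\<forall>h\<in>H. finite (set_pmf (message_law C h)) \<and>
           pmf_entropy (message_law C h) = real (block_length C) * r h)"
    using entropy_message_component[OF assms, of C] by auto
  then show ?thesis
    unfolding coding_solution_def computable_at_iff space_code_space[OF assms]
    by (simp add: case_prod_beta)
qed

lemma code_flow_eq:
  assumes "finite H" "\<forall>h\<in>H. finite (set_pmf (message_law C h))"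
  shows "code_flow H C a =
    pmf_entropy (map_pmf (arc_transmission C a) (Pi_pmf H 0 (message_law C))) / real (block_length C)"
  using assms by (simp add: code_flow_def message_space_eq entropy_bits_support_space finite_support_Pi_pmf)

lemma code_flow_nonneg:
  assumes "finite H" "coding_solution E r H C"
  shows "0 \<le> code_flow H C a"
  using assms by (subst code_flow_eq) (auto simp: coding_solution_def pmf_entropy_nonneg)

section \<open>Walks and shortest-path duality\<close>

inductive walk :: "'v set set \<Rightarrow> 'v \<Rightarrow> 'v arc list \<Rightarrow> 'v \<Rightarrow> bool" for E s where
  walk_Nil: "walk E s [] s"
| walk_snoc: "walk E s p u \<Longrightarrow> (u, v) \<in> arcs E \<Longrightarrow> walk E s (p @ [(u, v)]) v"

lemma walk_end:
  assumes "walk E s p v"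
  shows "v = s \<or> (\<exists>a\<in>set p. snd a = v)"
  using assms by cases auto

text \<open>Causality of forwarding: the tail of every arc is the source or the head of an earlier
  arc, so the message is there when it has to be sent on. Walks grow at the far end to match the
  order of transmissions.\<close>

lemma walk_nth:
  assumes "walk E s p v" "k < length p"
  shows "p ! k \<in> arcs E" "fst (p ! k) = s \<or> (\<exists>a\<in>set (take k p). snd a = fst (p ! k))"
  using assms
proof (induction arbitrary: k rule: walk.induct)
  case (walk_snoc p u v)
  {
    case 1
    then show ?case using walk_snoc by (auto simp: nth_append less_Suc_eq)
  next
    case 2
    then show ?case using walk_snoc walk_end[OF walk_snoc.hyps(1)]
      by (cases "k = length p") (auto simp: nth_append less_Suc_eq)
  }
qed auto

definition walk_weight :: "('v set \<Rightarrow> real) \<Rightarrow> 'v arc list \<Rightarrow> real" where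
  "walk_weight w p = (\<Sum>a\<leftarrow>p. w {fst a, snd a})"

lemma walk_weight_nonneg:
  assumes "\<forall>e\<in>E. 0 \<le> w e" "walk E s p v"
  shows "0 \<le> walk_weight w p"
  using assms(2,1) by (induction rule: walk.induct) (auto simp: walk_weight_def arcs_def)

text \<open>A walk may repeat arcs. Repeating a message on an arc adds no entropy, so the flow is
  charged per distinct arc, and the walk weight is an upper bound.\<close>

lemma sum_set_le_sum_list:
  fixes f :: "'a \<Rightarrow> real"
  assumes "\<And>a. a \<in> set p \<Longrightarrow> 0 \<le> f a"
  shows "(\<Sum>a\<in>set p. f a) \<le> (\<Sum>a\<leftarrow>p. f a)"
  using assms by (induction p) (auto simp: sum.insert_if add_increasing)

text \<open>Shortest-path duality: the distances from \<open>s\<close>, truncated at \<open>c\<close>, form a feasible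
  potential, which bounds the cost of the flow from below by \<open>\<rho> * c\<close> if all walks to \<open>t\<close> are
  heavier than \<open>c\<close>.\<close>

lemma exists_walk_weight_le_flow_cost:
  assumes G: "undirected_graph V E" and w: "\<forall>e\<in>E. 0 \<le> w e"
    and s: "s \<in> V" and t: "t \<in> V" and \<rho>: "0 < \<rho>" and \<epsilon>: "0 < \<epsilon>"
    and f: "\<And>a. a \<in> arcs E \<Longrightarrow> 0 \<le> f a"
    and div: "\<And>v. v \<in> V \<Longrightarrow> (\<Sum>a\<in>{a \<in> arcs E. fst a = v}. f a) - (\<Sum>a\<in>{a \<in> arcs E. snd a = v}. f a)
                = \<rho> * (of_bool (v = s) - of_bool (v = t))"
  shows "\<exists>p. walk E s p t \<and> \<rho> * walk_weight w p \<le> flow_cost E w f + \<epsilon>"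
proof (rule ccontr)
  assume none: "\<not> ?thesis"
  \<comment> \<open>The negated goal says exactly that every walk to \<open>t\<close> weighs more
    than \<open>c\<close>; the summand \<open>\<epsilon>\<close> provides the strict inequality that
    ends the proof.\<close>
  define c where "c = (flow_cost E w f + \<epsilon>) / \<rho>"
  define W where "W v = {walk_weight w p |p. walk E s p v}" for v
  \<comment> \<open>Inserting \<open>c\<close> truncates the distance and also keeps the set
    nonempty at vertices that no walk reaches.\<close>
  define d where "d v = Inf (insert c (W v))" for v
  have "0 \<le> flow_cost E w f" by (rule flow_cost_nonneg[OF G w f])
  then have c: "0 \<le> c" using \<rho> \<epsilon> by (simp add: c_def)
  have lb: "0 \<le> x" if "x \<in> insert c (W v)" for x v
    using that c walk_weight_nonneg[OF w] by (auto simp: W_def)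
  then have bdd: "bdd_below (insert c (W v))" for v by (rule bdd_belowI)
  have dle: "d v \<le> x" if "x \<in> insert c (W v)" for x v
    unfolding d_def by (rule cInf_lower[OF that bdd])
  have "d t = c"
    unfolding d_def
  proof (rule cInf_eq_minimum)
    fix x assume "x \<in> insert c (W t)"
    moreover have "c \<le> walk_weight w p" if "walk E s p t" for p
      using none that \<rho> by (force simp: c_def field_simps)
    ultimately show "c \<le> x" by (auto simp: W_def)
  qed simp
  have "0 \<in> W s" unfolding W_def by (auto simp: walk_weight_def intro!: exI[of _ "[]"] walk_Nil)
  then have "d s \<le> 0" by (intro dle) simp
  have step: "d v \<le> d u + w {u, v}" if uv: "(u, v) \<in> arcs E" for u v
  proof -
    have "d v - w {u, v} \<le> x" if "x \<in> insert c (W u)" for x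
    proof (cases "x = c")
      case True
      have "0 \<le> w {u, v}" using uv w by (simp add: arcs_def)
      then show ?thesis using dle[of c v] True by simp
    next
      case False
      then have "x \<in> W u" using that by blast
      then obtain p where p: "walk E s p u" "x = walk_weight w p"
        unfolding W_def by blast
      have "x + w {u, v} \<in> W v"
        unfolding W_def p(2) using walk_snoc[OF p(1) uv]
        by (auto simp: walk_weight_def intro!: exI[of _ "p @ [(u, v)]"])
      then show ?thesis using dle[of "x + w {u, v}" v] by simp
    qed
    then have "d v - w {u, v} \<le> d u" unfolding d_def[of u] by (intro cInf_greatest) auto
    then show ?thesis by simp
  qed
  have finA: "finite (arcs E)" by (rule finite_arcs[OF G])
  have finV: "finite V" using G by (simp add: undirected_graph_def)
  have ends: "fst ` arcs E \<subseteq> V" "snd ` arcs E \<subseteq> V"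
    using G unfolding undirected_graph_def arcs_def by (fastforce simp: doubleton_eq_iff)+
  \<comment> \<open>Summation by parts: potential differences against the flow become the potential
    against its divergence, which lives on \<open>s\<close> and \<open>t\<close> only.\<close>
  have "(\<Sum>a\<in>arcs E. (d (snd a) - d (fst a)) * f a) =
      (\<Sum>a\<in>arcs E. d (snd a) * f a) - (\<Sum>a\<in>arcs E. d (fst a) * f a)"
    by (simp add: algebra_simps sum_subtractf)
  also have "(\<Sum>a\<in>arcs E. d (snd a) * f a) = (\<Sum>v\<in>V. d v * (\<Sum>a\<in>{a \<in> arcs E. snd a = v}. f a))"
    by (subst sum.group[OF finA finV ends(2), symmetric]) (simp add: sum_distrib_left)
  also have "(\<Sum>a\<in>arcs E. d (fst a) * f a) = (\<Sum>v\<in>V. d v * (\<Sum>a\<in>{a \<in> arcs E. fst a = v}. f a))"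
    by (subst sum.group[OF finA finV ends(1), symmetric]) (simp add: sum_distrib_left)
  also have "(\<Sum>v\<in>V. d v * (\<Sum>a\<in>{a \<in> arcs E. snd a = v}. f a)) -
      (\<Sum>v\<in>V. d v * (\<Sum>a\<in>{a \<in> arcs E. fst a = v}. f a)) =
      - (\<Sum>v\<in>V. d v * (\<rho> * (of_bool (v = s) - of_bool (v = t))))"
    by (simp add: sum_subtractf[symmetric] right_diff_distrib[symmetric] sum_negf[symmetric] div[symmetric] del: sum_subtractf)
      (simp add: algebra_simps)
  also have "\<dots> = (\<Sum>v\<in>V. \<rho> * (if v = t then d v else 0) - \<rho> * (if v = s then d v else 0))"
    unfolding sum_negf[symmetric] by (intro sum.cong) auto
  also have "\<dots> = \<rho> * d t - \<rho> * d s"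
    using finV s t by (simp add: sum_subtractf sum_distrib_left[symmetric] sum.delta)
  finally have "\<rho> * d t - \<rho> * d s = (\<Sum>a\<in>arcs E. (d (snd a) - d (fst a)) * f a)" ..
  also have "\<dots> \<le> (\<Sum>a\<in>arcs E. w {fst a, snd a} * f a)"
    by (intro sum_mono mult_right_mono f) (use step in \<open>auto simp: diff_le_eq add.commute\<close>)
  finally have "\<rho> * d t - \<rho> * d s \<le> (\<Sum>a\<in>arcs E. w {fst a, snd a} * f a)" .
  moreover have "\<rho> * d s \<le> 0" using \<open>d s \<le> 0\<close> \<rho> by (simp add: mult_nonneg_nonpos)
  ultimately show False
    using \<rho> \<epsilon> unfolding \<open>d t = c\<close> flow_cost_eq_sum_arcs[OF G, symmetric] by (simp add: c_def)
qed

subsection \<open>Routing a session on top of a code\<close>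

lemma J_code_nonneg:
  assumes "undirected_graph V E" "\<forall>e\<in>E. 0 \<le> w e" "finite H"
  shows "0 \<le> J_code E w r H"
  unfolding J_code_def
  by (intro INF_greatest) (auto intro!: flow_cost_nonneg[OF assms(1,2)] code_flow_nonneg[OF assms(3)])

lemma J_code_le:
  assumes "coding_solution E r H C"
  shows "J_code E w r H \<le> ereal (flow_cost E w (code_flow H C))"
  unfolding J_code_def by (rule INF_lower) (simp add: assms)

text \<open>The new session is served by sending its whole message over every arc of \<open>p\<close>, after the
  transmissions of \<open>C\<close>. Since any nonnegative real is an entropy, the block length of \<open>C\<close> can be
  kept.\<close>

lemma coding_solution_insert_walk:
  fixes C :: "'v code"
  assumes G: "undirected_graph V E" and w: "\<forall>e\<in>E. 0 \<le> w e"
    and fin: "finite H" and h: "h \<notin> H" and rh: "0 \<le> r h"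
    and C: "coding_solution E r H C"
    and p: "walk E (fst h) p v" and v: "v = snd h \<or> r h = 0"
  shows "\<exists>C'. coding_solution E r (insert h H) C' \<and>
    flow_cost E w (code_flow (insert h H) C') \<le> flow_cost E w (code_flow H C) + r h * walk_weight w p"
proof -
  define n where "n = block_length C"
  define ts where "ts = transmissions C"
  note C' = C[unfolded coding_solution_iff[OF fin], folded n_def ts_def]
  have n: "0 < n" using C' by blast
  \<comment> \<open>At rate 0 the message is constantly 0. The sink then knows it in advance, which
    is needed because \<open>p\<close> may end elsewhere.\<close>
  obtain q :: "nat pmf" where q: "finite (set_pmf q)" "pmf_entropy q = real n * r h"
    and q0: "r h = 0 \<Longrightarrow> q = return_pmf 0"
  proof (cases "r h = 0")
    case True
    then show ?thesis using that[of "return_pmf 0"] by (simp add: pmf_entropy_def)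
  next
    case False
    then show ?thesis using exists_pmf_entropy[of "real n * r h"] rh that by auto
  qed
  \<comment> \<open>The conditions on \<open>C\<close> speak only of tuples whose component
    \<open>h\<close> has the default value 0, so the old symbols are evaluated after resetting that
    component.\<close>
  define old where "old = map (\<lambda>(a, X). (a, \<lambda>m. X (m(h := 0)))) ts"
  define new where "new = map (\<lambda>a. (a, \<lambda>m :: 'v messages. m h)) p"
  define D where "D = \<lparr>block_length = n, message_law = (message_law C)(h := q), transmissions = old @ new\<rparr>"
  let ?H = "insert h H"
  let ?S = "code_tuples H C" and ?S' = "code_tuples ?H D"
  have reset: "m(h := 0) \<in> ?S" if "m \<in> ?S'" for m
    using that h by (auto simp: code_tuples_def PiE_dflt_def D_def split: if_splits)
  have lift: "computable_at ?H ?S' u (map (\<lambda>(a, X). (a, \<lambda>m. X (m(h := 0)))) us @ vs) (\<lambda>m. X (m(h := 0)))"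
    if "computable_at H ?S u us X" for u us vs X
    unfolding computable_at_def
  proof (intro ballI impI)
    fix m m' assume m: "m \<in> ?S'" "m' \<in> ?S'"
      and msg: "\<forall>h'\<in>?H. fst h' = u \<longrightarrow> m h' = m' h'"
      and rec: "\<forall>(a, Y)\<in>set (map (\<lambda>(a, X). (a, \<lambda>m. X (m(h := 0)))) us @ vs). snd a = u \<longrightarrow> Y m = Y m'"
    have "\<forall>h'\<in>H. fst h' = u \<longrightarrow> (m(h := 0)) h' = (m'(h := 0)) h'" using msg by auto
    moreover have "\<forall>(a, Y)\<in>set us. snd a = u \<longrightarrow> Y (m(h := 0)) = Y (m'(h := 0))"
      using rec by (simp add: ball_Un case_prod_beta)
    ultimately show "X (m(h := 0)) = X (m'(h := 0))"
      using that reset[OF m(1)] reset[OF m(2)] unfolding computable_at_def by blast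
  qed
  have fwd: "computable_at ?H ?S' u (us @ map (\<lambda>a. (a, \<lambda>m. m h)) p') (\<lambda>m. m h)"
    if "u = fst h \<or> (\<exists>a\<in>set p'. snd a = u)" for u us p'
    using that unfolding computable_at_def by fastforce
  have sol: "coding_solution E r ?H D"
    unfolding coding_solution_iff[OF finite.insertI[OF fin]]
  proof (intro conjI ballI allI impI)
    show "block_length D > 0" using n by (simp add: D_def)
    show "finite (set_pmf (message_law D h'))" if "h' \<in> ?H" for h'
      using that C' q by (auto simp: D_def)
    show "pmf_entropy (message_law D h') = real (block_length D) * r h'" if "h' \<in> ?H" for h'
      using that C' q by (auto simp: D_def)
    fix k assume "k < length (transmissions D)"
    then consider "k < length ts" | j where "k = length ts + j" "j < length p"
      by (auto simp: D_def old_def new_def) (metis add_diff_inverse_nat less_diff_conv2 not_less nat_add_left_cancel_less)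
    then have "fst (transmissions D ! k) \<in> arcs E \<and> computable_at ?H ?S' (fst (fst (transmissions D ! k)))
      (take k (transmissions D)) (snd (transmissions D ! k))"
    proof cases
      case 1
      then have "transmissions D ! k = (fst (ts ! k), \<lambda>m. snd (ts ! k) (m(h := 0)))"
        "take k (transmissions D) = map (\<lambda>(a, X). (a, \<lambda>m. X (m(h := 0)))) (take k ts) @ []"
        by (simp_all add: D_def old_def nth_append take_map case_prod_beta)
      then show ?thesis using C' 1 lift[of "fst (fst (ts ! k))" "take k ts" "snd (ts ! k)" "[]"] by simp
    next
      case 2
      then have "transmissions D ! k = (p ! j, \<lambda>m. m h)"
        "take k (transmissions D) = old @ map (\<lambda>a. (a, \<lambda>m. m h)) (take j p)"
        by (simp_all add: D_def old_def new_def nth_append take_map)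
      then show ?thesis using walk_nth[OF p 2(2)] fwd[of "fst (p ! j)" "take j p" old] by simp
    qed
    then show "fst (transmissions D ! k) \<in> arcs E"
      "computable_at ?H ?S' (fst (fst (transmissions D ! k))) (take k (transmissions D)) (snd (transmissions D ! k))"
      by blast+
  next
    fix h' assume h': "h' \<in> ?H"
    show "computable_at ?H ?S' (snd h') (transmissions D) (\<lambda>m. m h')"
    proof (cases "h' = h")
      case False
      then have "computable_at H ?S (snd h') ts (\<lambda>m. m h')" using C' h' by blast
      from lift[OF this] False show ?thesis by (simp add: D_def old_def)
    next
      case True
      show ?thesis
      proof (cases "r h = 0")
        case True
        have zero: "m h = 0" if "m \<in> ?S'" for m
        proof -
          have "m h \<in> (set_pmf \<circ> message_law D) h"
            using that unfolding code_tuples_def PiE_dflt_def by blast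
          then show ?thesis using q0[OF True] by (simp add: D_def)
        qed
        show ?thesis
          unfolding computable_at_def \<open>h' = h\<close> by (intro ballI impI) (metis zero)
      next
        case False
        then have "snd h = fst h \<or> (\<exists>a\<in>set p. snd a = snd h)" using v walk_end[OF p] by blast
        from fwd[OF this] show ?thesis unfolding \<open>h' = h\<close> by (simp add: D_def new_def)
      qed
    qed
  qed
  have flow: "code_flow ?H D a \<le> code_flow H C a + of_bool (a \<in> set p) * r h" for a
  proof -
    let ?P = "Pi_pmf H 0 (message_law C)"
    let ?T = "arc_transmission C a"
    let ?g = "\<lambda>y :: nat. if a \<in> set p then y else 0"
    have lawC: "\<forall>h'\<in>H. finite (set_pmf (message_law C h'))" using C' by blast
    then have finP: "finite (set_pmf ?P)" by (rule finite_support_Pi_pmf[OF fin])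
    have law: "Pi_pmf ?H 0 (message_law D) = map_pmf (\<lambda>(y, f). f(h := y)) (pair_pmf q ?P)"
      using h by (subst Pi_pmf_insert[OF fin h])
        (auto simp: D_def intro!: arg_cong[where f = "\<lambda>P. map_pmf _ (pair_pmf q P)"] Pi_pmf_cong)
    have upd: "f(h := 0) = f" if "f \<in> set_pmf ?P" for f
      using that h set_Pi_pmf_subset[OF fin, of 0 "message_law C"] by (auto simp: fun_eq_iff)
    have "pmf_entropy (map_pmf (arc_transmission D a) (Pi_pmf ?H 0 (message_law D))) =
        pmf_entropy (map_pmf (\<lambda>(y, f). arc_transmission D a (f(h := y))) (pair_pmf q ?P))"
      unfolding law pmf.map_comp by (simp add: comp_def case_prod_unfold)
    \<comment> \<open>The old symbols on \<open>a\<close> depend on \<open>f\<close> alone, and the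
      new ones, present only if \<open>p\<close> uses \<open>a\<close>, all equal \<open>y\<close>.
      However often \<open>p\<close> uses \<open>a\<close>, the message therefore counts
      once.\<close>
    also have "\<dots> \<le> pmf_entropy (map_pmf (\<lambda>(y, f). (?g y, ?T f)) (pair_pmf q ?P))"
    proof (rule pmf_entropy_map_le_of_kernel, goal_cases)
      case 1
      then show ?case using q finP by simp
    next
      case (2 m m')
      obtain y f y' f' where m: "m = (y, f)" "m' = (y', f')" by (cases m, cases m')
      have "f(h := 0) = f" "f'(h := 0) = f'" using 2 upd by (auto simp: m)
      then show ?case
        using 2(3) by (auto simp: m arc_transmission_eq_iff D_def old_def new_def ts_def split: if_splits)
    qed
    also have "\<dots> = pmf_entropy (map_pmf ?g q) + pmf_entropy (map_pmf ?T ?P)"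
      using q finP by (simp add: map_pair pmf_entropy_pair)
    also have "pmf_entropy (map_pmf ?g q) \<le> of_bool (a \<in> set p) * (real n * r h)"
      using q by (auto simp: pmf_entropy_def[of "return_pmf _"] map_pmf_const)
    finally have "pmf_entropy (map_pmf (arc_transmission D a) (Pi_pmf ?H 0 (message_law D))) / real n
       \<le> (of_bool (a \<in> set p) * (real n * r h) + pmf_entropy (map_pmf ?T ?P)) / real n"
      using n by (intro divide_right_mono) auto
    moreover have "\<forall>h'\<in>?H. finite (set_pmf (message_law D h'))" using lawC q by (simp add: D_def)
    ultimately show ?thesis
      using n fin lawC by (simp add: code_flow_eq D_def add_divide_distrib n_def[symmetric] add.commute)
  qed
  have "set p \<subseteq> arcs E" using walk_nth(1)[OF p] by (metis in_set_conv_nth subsetI)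
  have "flow_cost E w (code_flow ?H D) \<le>
      flow_cost E w (\<lambda>a. code_flow H C a + of_bool (a \<in> set p) * r h)"
    by (rule flow_cost_mono[OF G w flow])
  also have "\<dots> = flow_cost E w (code_flow H C) + flow_cost E w (\<lambda>a. of_bool (a \<in> set p) * r h)"
    by (rule flow_cost_add)
  also have "flow_cost E w (\<lambda>a. of_bool (a \<in> set p) * r h) = r h * (\<Sum>a\<in>set p. w {fst a, snd a})"
    unfolding flow_cost_eq_sum_arcs[OF G] sum_distrib_left
    using \<open>set p \<subseteq> arcs E\<close> finite_arcs[OF G]
    by (intro sum.mono_neutral_cong_right) auto
  also have "\<dots> \<le> r h * walk_weight w p"
    unfolding walk_weight_def using \<open>set p \<subseteq> arcs E\<close> w
    by (intro mult_left_mono rh sum_set_le_sum_list) (auto simp: arcs_def)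
  finally show ?thesis using sol by auto
qed

section \<open>From single walks to the minimum costs\<close>

lemma routing_solution_cost_nonneg:
  assumes "undirected_graph V E" "\<forall>e\<in>E. 0 \<le> w e" "routing_solution V E r H \<phi>"
  shows "0 \<le> flow_cost E w (\<lambda>a. \<Sum>h\<in>H. \<phi> h a)"
  using assms(3) by (intro flow_cost_nonneg[OF assms(1,2)] sum_nonneg) (auto simp: routing_solution_def)

lemma J_route_nonneg:
  assumes "undirected_graph V E" "\<forall>e\<in>E. 0 \<le> w e"
  shows "0 \<le> J_route V E w r H"
  unfolding J_route_def
  by (intro INF_greatest) (auto intro: routing_solution_cost_nonneg[OF assms])

lemma J_code_insert_le:
  assumes G: "undirected_graph V E" and w: "\<forall>e\<in>E. 0 \<le> w e"
    and fin: "finite H" and h: "h \<notin> H" "h \<in> V \<times> V" and rh: "0 \<le> r h"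
    and \<phi>: "routing_solution V E r {h} \<phi>"
  shows "J_code E w r (insert h H) \<le> J_code E w r H + ereal (flow_cost E w (\<phi> h))"
proof -
  let ?c = "flow_cost E w (\<phi> h)"
  have f: "\<And>a. a \<in> arcs E \<Longrightarrow> 0 \<le> \<phi> h a"
    using \<phi> by (auto simp: routing_solution_def)
  \<comment> \<open>With the real number \<open>?c\<close> on the left, the infimum over all
    \<open>C\<close> can be taken on the right, also when there is no code at all.\<close>
  have "J_code E w r (insert h H) - ereal ?c \<le> ereal (flow_cost E w (code_flow H C))"
    if C: "coding_solution E r H C" for C
  proof -
    have "J_code E w r (insert h H) \<le> ereal (flow_cost E w (code_flow H C) + ?c)"
    proof (rule ereal_le_epsilon2)
      fix \<epsilon> :: real assume \<epsilon>: "0 < \<epsilon>"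
      \<comment> \<open>At rate 0 the sink may be unreachable, so the empty walk is taken.\<close>
      obtain p v where p: "walk E (fst h) p v" "v = snd h \<or> r h = 0"
        and cost: "r h * walk_weight w p \<le> ?c + \<epsilon>"
      proof (cases "r h = 0")
        case True
        then show ?thesis
          using that[OF walk_Nil] flow_cost_nonneg[OF G w f] \<epsilon> by simp
      next
        case False
        then have "\<exists>p. walk E (fst h) p (snd h) \<and> r h * walk_weight w p \<le> ?c + \<epsilon>"
          using h(2) rh \<phi>
          by (intro exists_walk_weight_le_flow_cost[OF G w _ _ _ \<epsilon> f]) (auto simp: routing_solution_def)
        then show ?thesis using that by blast
      qed
      obtain C' where C': "coding_solution E r (insert h H) C'"
        "flow_cost E w (code_flow (insert h H) C') \<le> flow_cost E w (code_flow H C) + r h * walk_weight w p"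
        using coding_solution_insert_walk[OF G w fin h(1) rh C p] by blast
      have "J_code E w r (insert h H) \<le> ereal (flow_cost E w (code_flow (insert h H) C'))"
        by (rule J_code_le[OF C'(1)])
      also have "\<dots> \<le> ereal (flow_cost E w (code_flow H C) + ?c) + ereal \<epsilon>"
        using C'(2) cost by simp
      finally show "J_code E w r (insert h H) \<le> ereal (flow_cost E w (code_flow H C) + ?c) + ereal \<epsilon>" .
    qed
    then show ?thesis by (simp add: ereal_minus_le)
  qed
  then have "J_code E w r (insert h H) - ereal ?c \<le> J_code E w r H"
    unfolding J_code_def[of E w r H] by (intro INF_greatest) simp
  then show ?thesis by (simp add: ereal_minus_le)
qed

lemma J_code_union_le_flow_cost:
  assumes G: "undirected_graph V E" and w: "\<forall>e\<in>E. 0 \<le> w e"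
    and "finite H1" "finite H2" "H1 \<inter> H2 = {}" "H2 \<subseteq> V \<times> V" "\<forall>h\<in>H2. 0 \<le> r h"
    and "routing_solution V E r H2 \<phi>"
  shows "J_code E w r (H1 \<union> H2) \<le> J_code E w r H1 + ereal (flow_cost E w (\<lambda>a. \<Sum>h\<in>H2. \<phi> h a))"
  using assms(4-)
proof (induction H2 rule: finite_induct)
  case empty
  then show ?case by (simp add: flow_cost_def edge_flow_def zero_ereal_def[symmetric])
next
  case (insert h H2)
  let ?c = "flow_cost E w (\<lambda>a. \<Sum>h\<in>H2. \<phi> h a)"
  have "J_code E w r (insert h (H1 \<union> H2)) \<le> J_code E w r (H1 \<union> H2) + ereal (flow_cost E w (\<phi> h))"
    using insert assms(3) by (intro J_code_insert_le[OF G w]) (auto simp: routing_solution_def)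
  also have "J_code E w r (H1 \<union> H2) \<le> J_code E w r H1 + ereal ?c"
    using insert by (intro insert.IH) (auto simp: routing_solution_def)
  also have "J_code E w r H1 + ereal ?c + ereal (flow_cost E w (\<phi> h)) =
      J_code E w r H1 + ereal (flow_cost E w (\<lambda>a. \<Sum>h\<in>insert h H2. \<phi> h a))"
    using insert.hyps flow_cost_add[of E w "\<phi> h" "\<lambda>a. \<Sum>h\<in>H2. \<phi> h a"]
    by (cases "J_code E w r H1") (simp_all add: add.commute)
  finally show ?case by (simp add: add_right_mono)
qed

text \<open>Adding a constant commutes with an infimum over a nonempty set of routings; over the
  empty set the right-hand side is \<open>\<infinity>\<close>.\<close>

lemma J_code_union_le:
  assumes G: "undirected_graph V E" and w: "\<forall>e\<in>E. 0 \<le> w e"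
    and fin: "finite H1" "finite H2" and H: "H1 \<inter> H2 = {}" "H2 \<subseteq> V \<times> V" "\<forall>h\<in>H2. 0 \<le> r h"
  shows "J_code E w r (H1 \<union> H2) \<le> J_code E w r H1 + J_route V E w r H2"
proof (cases "{\<phi>. routing_solution V E r H2 \<phi>} = {}")
  case True
  have "J_code E w r H1 \<noteq> - \<infinity>" using J_code_nonneg[OF G w fin(1), of r] by auto
  then show ?thesis unfolding J_route_def True by (simp add: top_ereal_def)
next
  case False
  have "J_code E w r H1 \<noteq> - \<infinity>" using J_code_nonneg[OF G w fin(1), of r] by auto
  then have "J_code E w r H1 + J_route V E w r H2 =
      (INF \<phi>\<in>{\<phi>. routing_solution V E r H2 \<phi>}. J_code E w r H1 + ereal (flow_cost E w (\<lambda>a. \<Sum>h\<in>H2. \<phi> h a)))"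
    unfolding J_route_def
    by (intro INF_ereal_add_right[symmetric] False) (auto intro: routing_solution_cost_nonneg[OF G w])
  then show ?thesis
    using J_code_union_le_flow_cost[OF G w fin H] by (auto intro!: INF_greatest)
qed

lemma J_code_empty_le: "J_code E w r {} \<le> 0"
proof -
  let ?C = "\<lparr>block_length = 1, message_law = undefined, transmissions = []\<rparr>"
  have "coding_solution E r {} ?C" by (simp add: coding_solution_def)
  then have "J_code E w r {} \<le> ereal (flow_cost E w (code_flow {} ?C))"
    by (rule J_code_le)
  also have "code_flow {} ?C = (\<lambda>_. 0)"
    by (simp add: fun_eq_iff code_flow_eq pmf_entropy_def)
  finally show ?thesis by (simp add: flow_cost_def edge_flow_def zero_ereal_def)
qed

text \<open>The mixed bound with no coded session.\<close>

lemma J_code_le_J_route: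
  assumes "undirected_graph V E" "\<forall>e\<in>E. 0 \<le> w e" "finite H" "H \<subseteq> V \<times> V" "\<forall>h\<in>H. 0 \<le> r h"
  shows "J_code E w r H \<le> J_route V E w r H"
proof -
  have "J_code E w r ({} \<union> H) \<le> J_code E w r {} + J_route V E w r H"
    by (rule J_code_union_le) (use assms in auto)
  also have "\<dots> \<le> 0 + J_route V E w r H" by (intro add_right_mono J_code_empty_le)
  finally show ?thesis by simp
qed

text \<open>Without capacities the flows of different sessions do not interact: routings restrict to
  each half, and routings of the halves can be glued.\<close>

lemma J_route_union:
  assumes G: "undirected_graph V E" and w: "\<forall>e\<in>E. 0 \<le> w e"
    and fin: "finite H1" "finite H2" and H: "H1 \<inter> H2 = {}"
  shows "J_route V E w r (H1 \<union> H2) = J_route V E w r H1 + J_route V E w r H2"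
proof (rule antisym)
  let ?c = "\<lambda>H \<phi>. flow_cost E w (\<lambda>a. \<Sum>h\<in>H. \<phi> h a)"
  let ?R = "\<lambda>H. {\<phi>. routing_solution V E r H \<phi>}"
  have split: "?c (H1 \<union> H2) \<phi> = ?c H1 \<phi> + ?c H2 \<phi>" for \<phi>
    unfolding flow_cost_add[symmetric] by (simp add: sum.union_disjoint[OF fin H])
  show "J_route V E w r H1 + J_route V E w r H2 \<le> J_route V E w r (H1 \<union> H2)"
    unfolding J_route_def
  proof (rule INF_greatest)
    fix \<phi> assume "\<phi> \<in> ?R (H1 \<union> H2)"
    then have "\<phi> \<in> ?R H1" "\<phi> \<in> ?R H2" by (auto simp: routing_solution_def)
    then show "(INF \<phi>\<in>?R H1. ereal (?c H1 \<phi>)) + (INF \<phi>\<in>?R H2. ereal (?c H2 \<phi>)) \<le> ereal (?c (H1 \<union> H2) \<phi>)"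
      unfolding split plus_ereal.simps(1)[symmetric] by (intro add_mono INF_lower)
  qed
  show "J_route V E w r (H1 \<union> H2) \<le> J_route V E w r H1 + J_route V E w r H2"
  proof (cases "?R H1 = {} \<or> ?R H2 = {}")
    case True
    moreover have "J_route V E w r H = \<infinity>" if "?R H = {}" for H
      unfolding J_route_def that by (simp add: top_ereal_def)
    ultimately have "J_route V E w r H1 = \<infinity> \<or> J_route V E w r H2 = \<infinity>" by blast
    then show ?thesis
      using J_route_nonneg[OF G w, of r H1] J_route_nonneg[OF G w, of r H2] by auto
  next
    case False
    have "J_route V E w r (H1 \<union> H2) \<le> ereal (?c H1 \<phi>1) + ereal (?c H2 \<phi>2)"
      if \<phi>: "\<phi>1 \<in> ?R H1" "\<phi>2 \<in> ?R H2" for \<phi>1 \<phi>2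
    proof -
      define \<phi> where "\<phi> h = (if h \<in> H1 then \<phi>1 h else \<phi>2 h)" for h
      have "\<phi> \<in> ?R (H1 \<union> H2)"
        unfolding mem_Collect_eq routing_solution_def
      proof (rule ballI)
        fix h assume h: "h \<in> H1 \<union> H2"
        show "(\<forall>a\<in>arcs E. 0 \<le> \<phi> h a) \<and>
          (\<forall>v\<in>V. (\<Sum>a\<in>{a \<in> arcs E. fst a = v}. \<phi> h a) - (\<Sum>a\<in>{a \<in> arcs E. snd a = v}. \<phi> h a)
                = r h * (of_bool (v = fst h) - of_bool (v = snd h)))"
        proof (cases "h \<in> H1")
          case True
          then have "\<phi> h = \<phi>1 h" by (simp add: \<phi>_def)
          then show ?thesis
            using \<phi>(1) True unfolding mem_Collect_eq routing_solution_def by simp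
        next
          case False
          then have "\<phi> h = \<phi>2 h" "h \<in> H2" using h by (simp_all add: \<phi>_def)
          then show ?thesis
            using \<phi>(2) unfolding mem_Collect_eq routing_solution_def by simp
        qed
      qed
      then have "J_route V E w r (H1 \<union> H2) \<le> ereal (?c (H1 \<union> H2) \<phi>)"
        unfolding J_route_def by (rule INF_lower)
      also have "?c H1 \<phi> = ?c H1 \<phi>1" by (simp add: \<phi>_def)
      moreover have "?c H2 \<phi> = ?c H2 \<phi>2"
        using H by (intro arg_cong[where f = "flow_cost E w"] ext sum.cong) (auto simp: \<phi>_def)
      ultimately show ?thesis by (simp add: split)
    qed
    moreover have "J_route V E w r H1 + J_route V E w r H2 =
        (INF \<phi>1\<in>?R H1. INF \<phi>2\<in>?R H2. ereal (?c H1 \<phi>1) + ereal (?c H2 \<phi>2))"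
    proof -
      have "(INF \<phi>2\<in>?R H2. ereal (?c H1 \<phi>1) + ereal (?c H2 \<phi>2)) = ereal (?c H1 \<phi>1) + J_route V E w r H2" for \<phi>1
        unfolding J_route_def
        by (intro INF_ereal_add_right) (use False in \<open>auto intro: routing_solution_cost_nonneg[OF G w]\<close>)
      moreover have "(INF \<phi>1\<in>?R H1. ereal (?c H1 \<phi>1) + J_route V E w r H2) = J_route V E w r H1 + J_route V E w r H2"
        unfolding J_route_def[of V E w r H1]
        by (intro INF_ereal_add_left)
          (use False J_route_nonneg[OF G w, of r H2] in \<open>auto intro: routing_solution_cost_nonneg[OF G w]\<close>)
      ultimately show ?thesis by simp
    qed
    ultimately show ?thesis by (auto intro!: INF_greatest)
  qed
qed

subsection \<open>Splitting a code along independent sessions\<close>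

definition freeze :: "'v session set \<Rightarrow> 'v messages \<Rightarrow> 'v messages \<Rightarrow> 'v messages" where
  "freeze A c m = (\<lambda>h. if h \<in> A then m h else c h)"

text \<open>No transmission is deleted. Symbols that depended only on frozen messages become
  constants of entropy 0, and all positions in the list, hence causality, are preserved.\<close>

definition freeze_code :: "'v session set \<Rightarrow> 'v messages \<Rightarrow> 'v code \<Rightarrow> 'v code" where
  "freeze_code A c C =
     C\<lparr>transmissions := map (\<lambda>(a, X). (a, \<lambda>m. X (freeze A c m))) (transmissions C)\<rparr>"

lemma coding_solution_freeze:
  assumes fin: "finite H" and A: "A \<subseteq> H" and C: "coding_solution E r H C"
    and c: "c \<in> code_tuples H C"
  shows "coding_solution E r A (freeze_code A c C)"
proof -
  let ?S = "code_tuples H C" and ?S' = "code_tuples A (freeze_code A c C)"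
  note C' = C[unfolded coding_solution_iff[OF fin]]
  have emb: "freeze A c m \<in> ?S" if "m \<in> ?S'" for m
    using that c A by (auto simp: code_tuples_def PiE_dflt_def freeze_def freeze_code_def)
  have lift: "computable_at A ?S' u (map (\<lambda>(a, X). (a, \<lambda>m. X (freeze A c m))) us) (\<lambda>m. X (freeze A c m))"
    if "computable_at H ?S u us X" for u us X
    unfolding computable_at_def
  proof (intro ballI impI)
    fix m m' assume m: "m \<in> ?S'" "m' \<in> ?S'"
      and msg: "\<forall>h\<in>A. fst h = u \<longrightarrow> m h = m' h"
      and rec: "\<forall>(a, Y)\<in>set (map (\<lambda>(a, X). (a, \<lambda>m. X (freeze A c m))) us). snd a = u \<longrightarrow> Y m = Y m'"
    have "\<forall>h\<in>H. fst h = u \<longrightarrow> freeze A c m h = freeze A c m' h" using msg by (auto simp: freeze_def)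
    moreover have "\<forall>(a, Y)\<in>set us. snd a = u \<longrightarrow> Y (freeze A c m) = Y (freeze A c m')"
      using rec by (simp add: case_prod_beta)
    ultimately show "X (freeze A c m) = X (freeze A c m')"
      using that emb[OF m(1)] emb[OF m(2)] unfolding computable_at_def by blast
  qed
  show ?thesis
    unfolding coding_solution_iff[OF finite_subset[OF A fin]]
  proof (intro conjI ballI allI impI)
    fix k assume k: "k < length (transmissions (freeze_code A c C))"
    let ?t = "transmissions C ! k"
    have eq: "transmissions (freeze_code A c C) ! k = (fst ?t, \<lambda>m. snd ?t (freeze A c m))"
      "take k (transmissions (freeze_code A c C)) =
        map (\<lambda>(a, X). (a, \<lambda>m. X (freeze A c m))) (take k (transmissions C))"
      using k by (simp_all add: freeze_code_def case_prod_beta take_map)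
    have "k < length (transmissions C)" using k by (simp add: freeze_code_def)
    then have "fst ?t \<in> arcs E" "computable_at H ?S (fst (fst ?t)) (take k (transmissions C)) (snd ?t)"
      using C' by blast+
    then show "fst (transmissions (freeze_code A c C) ! k) \<in> arcs E"
      "computable_at A ?S' (fst (fst (transmissions (freeze_code A c C) ! k)))
        (take k (transmissions (freeze_code A c C))) (snd (transmissions (freeze_code A c C) ! k))"
      unfolding eq using lift by simp_all
  next
    fix h assume h: "h \<in> A"
    then have "computable_at H ?S (snd h) (transmissions C) (\<lambda>m. m h)" using C' A by blast
    from lift[OF this] h show "computable_at A ?S' (snd h) (transmissions (freeze_code A c C)) (\<lambda>m. m h)"
      by (simp add: freeze_code_def freeze_def)
  qed (use C' A in \<open>auto simp: freeze_code_def\<close>)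
qed

section \<open>Symbols that do not react to a set of messages\<close>

definition ignores :: "'v messages set \<Rightarrow> 'v session set \<Rightarrow> ('v messages \<Rightarrow> nat) \<Rightarrow> bool" where
  "ignores S A X \<longleftrightarrow> (\<forall>m\<in>S. \<forall>m'\<in>S. (\<forall>h. h \<notin> A \<longrightarrow> m h = m' h) \<longrightarrow> X m = X m')"

lemma ignoresD:
  assumes "ignores S A X" "m \<in> S" "m' \<in> S" "\<And>h. h \<notin> A \<Longrightarrow> m h = m' h"
  shows "X m = X m'"
  using assms unfolding ignores_def by blast

text \<open>Two tuples are joined by changing one component at a time; the hybrids stay in the set
  because it is a product.\<close>

lemma ignores_of_singletons:
  assumes "finite A" "\<And>i. i \<in> A \<Longrightarrow> ignores (PiE_dflt H d B) {i} X"
  shows "ignores (PiE_dflt H d B) A X"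
  using assms
proof (induction A rule: finite_induct)
  case empty
  then show ?case unfolding ignores_def by (metis empty_iff ext)
next
  case (insert i A)
  let ?S = "PiE_dflt H d B"
  show ?case unfolding ignores_def
  proof (intro ballI impI)
    fix m m' assume m: "m \<in> ?S" "m' \<in> ?S" and eq: "\<forall>h. h \<notin> insert i A \<longrightarrow> m h = m' h"
    have mid: "m(i := m' i) \<in> ?S" using m by (auto simp: PiE_dflt_def)
    have "X m = X (m(i := m' i))"
      by (rule ignoresD[OF insert.prems m(1) mid]) auto
    also have "\<dots> = X m'"
      by (rule ignoresD[OF insert.IH mid m(2)]) (use insert.prems eq in auto)
    finally show "X m = X m'" .
  qed
qed

text \<open>Message \<open>i\<close> and the remaining messages together determine the whole tuple,
  hence every symbol, as the criterion for zero information requires.\<close>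

lemma ignores_of_cond_mutual_info_zero:
  assumes fin: "finite H" "\<forall>h\<in>H. finite (set_pmf (message_law C h))" and i: "i \<in> H"
    and zero: "cond_mutual_info_bits (code_space H C) X (\<lambda>m. m i) (\<lambda>m. restrict m (H - {i})) = 0"
  shows "ignores (code_tuples H C) {i} X"
  unfolding ignores_def
proof (intro ballI impI)
  let ?P = "Pi_pmf H 0 (message_law C)"
  have supp: "set_pmf ?P = code_tuples H C" by (simp add: code_tuples_def set_Pi_pmf[OF fin(1)])
  fix m m' assume m: "m \<in> code_tuples H C" "m' \<in> code_tuples H C" and eq: "\<forall>h. h \<notin> {i} \<longrightarrow> m h = m' h"
  show "X m = X m'"
  proof (rule cond_mutual_info_bits_zero_imp[OF finite_support_Pi_pmf[OF fin] _ zero[unfolded message_space_eq]])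
    show "m \<in> set_pmf ?P" "m' \<in> set_pmf ?P" using m by (simp_all add: supp)
    show "restrict m (H - {i}) = restrict m' (H - {i})" using eq by (auto simp: restrict_def fun_eq_iff)
    fix a b assume ab: "a \<in> set_pmf ?P" "b \<in> set_pmf ?P" "a i = b i" "restrict a (H - {i}) = restrict b (H - {i})"
    have "a h = b h" for h
    proof (cases "h \<in> H - {i}")
      case True
      then show ?thesis using fun_cong[OF ab(4), of h] by simp
    next
      case False
      have "a h = 0" "b h = 0" if "h \<notin> H"
        using ab(1,2) that unfolding supp code_tuples_def PiE_dflt_def by blast+
      then show ?thesis using ab(3) False by (cases "h = i") auto
    qed
    then have "a = b" by blast
    then show "X a = X b" by simp
  qed
qed

text \<open>The two frozen codes run on independent messages, so their entropies on an arc add up to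
  a joint entropy. Symbol by symbol, the pair of frozen outputs is determined by the original
  output: a symbol ignoring one half is constant in the code for that half and unchanged in the
  other.\<close>

lemma code_flow_freeze_add_le:
  fixes C :: "'v code"
  assumes fin: "finite H1" "finite H2" and disj: "H1 \<inter> H2 = {}"
    and law: "\<forall>h\<in>H1 \<union> H2. finite (set_pmf (message_law C h))"
    and c: "c \<in> code_tuples (H1 \<union> H2) C"
    and sep: "\<And>a X. (a, X) \<in> set (transmissions C) \<Longrightarrow>
      ignores (code_tuples (H1 \<union> H2) C) H1 X \<or> ignores (code_tuples (H1 \<union> H2) C) H2 X"
  shows "code_flow H1 (freeze_code H1 c C) a + code_flow H2 (freeze_code H2 c C) a
    \<le> code_flow (H1 \<union> H2) C a"
proof -
  let ?S = "code_tuples (H1 \<union> H2) C"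
  let ?P = "\<lambda>A. Pi_pmf A 0 (message_law C)"
  let ?T = "arc_transmission C a"
  let ?T1 = "arc_transmission (freeze_code H1 c C) a" and ?T2 = "arc_transmission (freeze_code H2 c C) a"
  let ?m = "\<lambda>f g x. if x \<in> H1 then f x else g x"
  have finP: "finite (set_pmf (?P H1))" "finite (set_pmf (?P H2))"
    using fin law by (auto intro!: finite_support_Pi_pmf)
  have supp: "f \<in> set_pmf (?P A) \<longleftrightarrow> f \<in> PiE_dflt A 0 (set_pmf \<circ> message_law C)" if "finite A" for f A
    by (simp add: set_Pi_pmf[OF that])
  have "pmf_entropy (map_pmf ?T1 (?P H1)) + pmf_entropy (map_pmf ?T2 (?P H2)) =
      pmf_entropy (map_pmf (\<lambda>(f, g). (?T1 f, ?T2 g)) (pair_pmf (?P H1) (?P H2)))"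
    using finP by (simp add: map_pair pmf_entropy_pair)
  also have "\<dots> \<le> pmf_entropy (map_pmf (\<lambda>(f, g). ?T (?m f g)) (pair_pmf (?P H1) (?P H2)))"
  proof (rule pmf_entropy_map_le_of_kernel, goal_cases)
    case 1
    then show ?case using finP by simp
  next
    case (2 k k')
    obtain f g f' g' where k: "k = (f, g)" "k' = (f', g')" by (cases k, cases k')
    have f: "f \<in> PiE_dflt H1 0 (set_pmf \<circ> message_law C)" "f' \<in> PiE_dflt H1 0 (set_pmf \<circ> message_law C)"
      and g: "g \<in> PiE_dflt H2 0 (set_pmf \<circ> message_law C)" "g' \<in> PiE_dflt H2 0 (set_pmf \<circ> message_law C)"
      using 2(1,2) by (auto simp: k supp fin)
    have S: "?m f g \<in> ?S" "?m f' g' \<in> ?S" "freeze H1 c f \<in> ?S" "freeze H1 c f' \<in> ?S"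
      "freeze H2 c g \<in> ?S" "freeze H2 c g' \<in> ?S"
      using f g c by (auto simp: code_tuples_def PiE_dflt_def freeze_def)
    \<comment> \<open>\<open>ignoresD\<close> asks for agreement at every session outside the
      ignored set, including those outside \<open>H1 \<union> H2\<close>, where all tuples have the
      default value 0.\<close>
    have off: "?m f g h = 0" "?m f' g' h = 0" "c h = 0" if "h \<notin> H1 \<union> H2" for h
    proof -
      have "f h = 0 \<and> f' h = 0 \<and> g h = 0 \<and> g' h = 0 \<and> c h = 0"
        using that f g c unfolding code_tuples_def PiE_dflt_def by blast
      then show "?m f g h = 0" "?m f' g' h = 0" "c h = 0" by simp_all
    qed
    have "X (freeze H1 c f) = X (freeze H1 c f') \<and> X (freeze H2 c g) = X (freeze H2 c g')"
      if X: "(a, X) \<in> set (transmissions C)" for X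
    proof -
      have all: "X (?m f g) = X (?m f' g')"
        using 2(3) X by (auto simp: k arc_transmission_eq_iff)
      from sep[OF X] show ?thesis
      proof
        assume ign: "ignores ?S H1 X"
        have "X (freeze H1 c f) = X (freeze H1 c f')"
          by (rule ignoresD[OF ign]) (use S in \<open>auto simp: freeze_def\<close>)
        \<comment> \<open>The two arguments differ only on \<open>H1\<close>, which \<open>X\<close>
          ignores.\<close>
        moreover have "X (freeze H2 c g) = X (?m f g)" "X (freeze H2 c g') = X (?m f' g')"
          by (rule ignoresD[OF ign]; use S off disj in \<open>auto simp: freeze_def\<close>)+
        ultimately show ?thesis using all by simp
      next
        assume ign: "ignores ?S H2 X"
        have "X (freeze H2 c g) = X (freeze H2 c g')"
          by (rule ignoresD[OF ign]) (use S in \<open>auto simp: freeze_def\<close>)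
        moreover have "X (freeze H1 c f) = X (?m f g)" "X (freeze H1 c f') = X (?m f' g')"
          by (rule ignoresD[OF ign]; use S off disj in \<open>auto simp: freeze_def\<close>)+
        ultimately show ?thesis using all by simp
      qed
    qed
    then show ?case
      by (auto simp: k arc_transmission_eq_iff freeze_code_def)
  qed
  also have "\<dots> = pmf_entropy (map_pmf ?T (?P (H1 \<union> H2)))"
    unfolding Pi_pmf_union[OF fin disj] pmf.map_comp by (simp add: comp_def case_prod_unfold)
  finally show ?thesis
    using law fin
    by (simp add: code_flow_eq freeze_code_def add_divide_distrib[symmetric] divide_right_mono)
qed

lemma J_code_add_le_of_independent:
  assumes G: "undirected_graph V E" and w: "\<forall>e\<in>E. 0 \<le> w e"
    and fin: "finite H1" "finite H2" and ind: "independent_sessions E w r (H1 \<union> H2) H1 H2"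
  shows "J_code E w r H1 + J_code E w r H2 \<le> J_code E w r (H1 \<union> H2)"
proof -
  let ?H = "H1 \<union> H2"
  obtain C where C: "coding_solution E r ?H C"
    and opt: "ereal (flow_cost E w (code_flow ?H C)) = J_code E w r ?H"
    and zero: "\<And>i j a X. i \<in> H1 \<Longrightarrow> j \<in> H2 \<Longrightarrow> (a, X) \<in> set (transmissions C) \<Longrightarrow> {fst a, snd a} \<in> E \<Longrightarrow>
          cond_mutual_info_bits (code_space ?H C) X (\<lambda>m. m i) (\<lambda>m. restrict m (?H - {i})) *
          cond_mutual_info_bits (code_space ?H C) X (\<lambda>m. m j) (\<lambda>m. restrict m (?H - {j})) = 0"
    and disj: "H1 \<inter> H2 = {}"
  proof -
    obtain C where C: "min_cost_coding_solution E w r ?H C"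
      and zero: "\<forall>i\<in>H1. \<forall>j\<in>H2. \<forall>e\<in>E. \<forall>(a, X) \<in> set (transmissions C). {fst a, snd a} = e \<longrightarrow>
           cond_mutual_info_bits (code_space ?H C) X (\<lambda>m. m i) (\<lambda>m. restrict m (?H - {i})) *
           cond_mutual_info_bits (code_space ?H C) X (\<lambda>m. m j) (\<lambda>m. restrict m (?H - {j})) = 0"
      using ind unfolding independent_sessions_def by (elim conjE exE)
    show thesis
    proof (rule that)
      show "coding_solution E r ?H C" "ereal (flow_cost E w (code_flow ?H C)) = J_code E w r ?H"
        using C by (simp_all add: min_cost_coding_solution_def)
      show "H1 \<inter> H2 = {}" using ind by (simp add: independent_sessions_def)
      show "cond_mutual_info_bits (code_space ?H C) X (\<lambda>m. m i) (\<lambda>m. restrict m (?H - {i})) *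
          cond_mutual_info_bits (code_space ?H C) X (\<lambda>m. m j) (\<lambda>m. restrict m (?H - {j})) = 0"
        if "i \<in> H1" "j \<in> H2" "(a, X) \<in> set (transmissions C)" "{fst a, snd a} \<in> E" for i j a X
        using bspec[OF bspec[OF bspec[OF bspec[OF zero that(1)] that(2)] that(4)] that(3)] by simp
    qed
  qed
  have finH: "finite ?H" using fin by simp
  note C' = C[unfolded coding_solution_iff[OF finH]]
  have law: "\<forall>h\<in>?H. finite (set_pmf (message_law C h))" using C' by blast
  let ?S = "code_tuples ?H C"
  have "?S \<noteq> {}" by (simp add: code_tuples_def set_pmf_not_empty)
  then obtain c where c: "c \<in> ?S" by blast
  have sep: "ignores ?S H1 X \<or> ignores ?S H2 X" if X: "(a, X) \<in> set (transmissions C)" for a X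
  proof -
    obtain k where "k < length (transmissions C)" "transmissions C ! k = (a, X)"
      using X by (auto simp: in_set_conv_nth)
    moreover have "\<forall>k < length (transmissions C). fst (transmissions C ! k) \<in> arcs E" using C' by blast
    ultimately have "a \<in> arcs E" by fastforce
    then have e: "{fst a, snd a} \<in> E" by (auto simp: arcs_def)
    \<comment> \<open>Independence is stated pair by pair. One message of each half influencing
      \<open>X\<close> would already make a product nonzero, so for each symbol one half is ignored
      as a whole.\<close>
    have "(\<forall>i\<in>H1. ignores ?S {i} X) \<or> (\<forall>j\<in>H2. ignores ?S {j} X)"
    proof (rule ccontr)
      assume "\<not> ?thesis"
      then obtain i j where ij: "i \<in> H1" "j \<in> H2" "\<not> ignores ?S {i} X" "\<not> ignores ?S {j} X" by blast
      then show False
        using zero[OF ij(1,2) X e] ignores_of_cond_mutual_info_zero[OF finH law, of i X]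
          ignores_of_cond_mutual_info_zero[OF finH law, of j X] by auto
    qed
    then show ?thesis
      using ignores_of_singletons fin unfolding code_tuples_def by blast
  qed
  let ?C1 = "freeze_code H1 c C" and ?C2 = "freeze_code H2 c C"
  have "J_code E w r H1 + J_code E w r H2 \<le>
      ereal (flow_cost E w (code_flow H1 ?C1)) + ereal (flow_cost E w (code_flow H2 ?C2))"
    using C c finH by (intro add_mono J_code_le coding_solution_freeze[of ?H]) auto
  also have "\<dots> = ereal (flow_cost E w (\<lambda>a. code_flow H1 ?C1 a + code_flow H2 ?C2 a))"
    by (simp add: flow_cost_add)
  also have "\<dots> \<le> ereal (flow_cost E w (code_flow ?H C))"
    using flow_cost_mono[OF G w code_flow_freeze_add_le[OF fin disj law c sep]] by simp
  finally show ?thesis unfolding opt .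
qed

theorem mainTheorem5:
  fixes V :: "'v set" and E :: "'v set set"
    and H H1 H2 :: "'v session set"
    and r :: "'v session \<Rightarrow> real" and w :: "'v set \<Rightarrow> real"
  assumes "undirected_graph V E"
    and "H \<subseteq> V \<times> V"
    and "\<forall>h\<in>H. 0 \<le> r h"
    and "\<forall>e\<in>E. 0 \<le> w e"
    and "H1 \<union> H2 = H" and "H1 \<inter> H2 = {}"
    and "independent_sessions E w r H H1 H2"
  shows "J_code E w r H = J_route V E w r H \<longleftrightarrow>
     J_code E w r H1 = J_route V E w r H1 \<and> J_code E w r H2 = J_route V E w r H2"
proof -
  note G = assms(1) and w = assms(4)
  have "finite H" using assms(1,2) by (meson finite_SigmaI finite_subset undirected_graph_def)
  then have fin: "finite H1" "finite H2" using assms(5) by auto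
  have sub: "H1 \<subseteq> V \<times> V" "H2 \<subseteq> V \<times> V" and r: "\<forall>h\<in>H1. 0 \<le> r h" "\<forall>h\<in>H2. 0 \<le> r h"
    using assms(2,3,5) by auto
  let ?c = "J_code E w r" and ?R = "J_route V E w r"
  have mixed1: "?c H \<le> ?c H1 + ?R H2"
    using J_code_union_le[OF G w fin assms(6) sub(2) r(2)] assms(5) by simp
  have mixed2: "?c H \<le> ?c H2 + ?R H1"
    using J_code_union_le[OF G w fin(2,1) _ sub(1) r(1)] assms(5,6) by (simp add: Un_commute Int_commute)
  have route: "?R H = ?R H1 + ?R H2"
    using J_route_union[OF G w fin assms(6)] assms(5) by simp
  have le: "?c H \<le> ?R H" "?c H1 \<le> ?R H1" "?c H2 \<le> ?R H2"
    using J_code_le_J_route[OF G w \<open>finite H\<close> assms(2,3)] J_code_le_J_route[OF G w fin(1) sub(1) r(1)]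
      J_code_le_J_route[OF G w fin(2) sub(2) r(2)] by blast+
  have super: "?c H1 + ?c H2 \<le> ?c H"
    using J_code_add_le_of_independent[OF G w fin] assms(5,7) by simp
  have nonneg: "0 \<le> ?R H1" "0 \<le> ?R H2" by (rule J_route_nonneg[OF G w])+
  show ?thesis
  proof
    assume eq: "?c H = ?R H"
    \<comment> \<open>An attained minimum is a real number, so both routing costs are finite and can
      be cancelled from the mixed bounds.\<close>
    obtain C where "min_cost_coding_solution E w r H C"
      using assms(7) unfolding independent_sessions_def by (elim conjE exE)
    then have "?c H = ereal (flow_cost E w (code_flow H C))"
      by (simp add: min_cost_coding_solution_def)
    then have "?c H < \<infinity>" by simp
    then have finR: "\<bar>?R H1\<bar> \<noteq> \<infinity>" "\<bar>?R H2\<bar> \<noteq> \<infinity>"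
      using eq nonneg unfolding route by auto
    have "?R H1 + ?R H2 \<le> ?c H1 + ?R H2" "?R H2 + ?R H1 \<le> ?c H2 + ?R H1"
      using mixed1 mixed2 eq route by (simp_all add: add.commute)
    then have "?R H1 \<le> ?c H1" "?R H2 \<le> ?c H2"
      using finR by (cases "?R H1"; cases "?R H2"; cases "?c H1"; cases "?c H2"; simp)+
    then show "?c H1 = ?R H1 \<and> ?c H2 = ?R H2" using le by (simp add: antisym)
  next
    \<comment> \<open>Here J_route(H) = J_code(H1) + J_code(H2) <= J_code(H) <= J_route(H).\<close>
    assume "?c H1 = ?R H1 \<and> ?c H2 = ?R H2"
    then show "?c H = ?R H" using super le(1) route by simp
  qed
qed

end
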